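(* Let $F$ be a graph. For all nonnegative integers $n,m,t$, the number $\mathrm{SG}^F_{n,m,t}$ of $(n,m)$-graphs that contain exactly $t$ $F$-subgraphs is $$\mathrm{SG}^F_{n,m,t} = n!\,[z^n w^m u^t]\; \mathrm{Patch}_F\!\left(z,\frac{w}{1+w},u-1\right) e^{z}(1+w)^{\binom{n}{2}} .$$
   Context: A graph $G=(V(G),E(G))$ has a finite set of labeled vertices and a set of edges, each an unordered pair of distinct vertices (no loops, no multiple edges). An $(n,m)$-graph is a graph with $n$ vertices, labeled from $1$ to $n$, and $m$ edges. $S$ is a subgraph of $G$ if $V(S)\subset V(G)$ and $E(S)\subset E(G)$. Two graphs are isomorphic if there is a bijection between their vertex sets inducing a bijection between their edge sets. An $F$-graph is a graph isomorphic to $F$; an $F$-subgraph of $G$ is a subgraph of $G$ that is an $F$-graph. An $F$-patchwork $P$ is a (possibly empty) set of distinct $F$-graphs $\{F_1,\dots,F_t\}$, which may share vertices and edges, such that the pair $G(P)=\left(\bigcup_{i=1}^t V(F_i),\bigcup_{i=1}^t E(F_i)\right)$ is a graph. Let $\mathrm{Patch}_{F,n,m,t}$ be the number of $F$-patchworks composed of $t$ $F$-graphs and such that $G(P)$ is an $(n,m)$-graph. The generating function of $F$-patchworks is $$\mathrm{Patch}_F(z,w,u)=\sum_{n,m,t\ge 0}\mathrm{Patch}_{F,n,m,t}\,u^t w^m\frac{z^n}{n!}.$$ For each fixed $(n,m)$ only finitely many $t$ give a nonzero term, so the substitution $u\mapsto u-1$ is well defined. $[z^n w^m u^t]$ denotes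 coefficient extraction. *)

theory Defs
  imports "HOL-Computational_Algebra.Computational_Algebra"
begin

type_synonym 'a graph = "'a set \<times> 'a set set"

abbreviation verts :: "'a graph \<Rightarrow> 'a set" where "verts \<equiv> fst"
abbreviation edges :: "'a graph \<Rightarrow> 'a set set" where "edges \<equiv> snd"

definition is_graph :: "'a graph \<Rightarrow> bool" where
  "is_graph G \<longleftrightarrow> finite (verts G) \<and> (\<forall>e\<in>edges G. e \<subseteq> verts G \<and> card e = 2)"

definition nm_graph :: "nat \<Rightarrow> nat \<Rightarrow> nat graph \<Rightarrow> bool" where
  "nm_graph n m G \<longleftrightarrow> is_graph G \<and> verts G = {1..n} \<and> card (edges G) = m"

definition subgraph :: "'a graph \<Rightarrow> 'a graph \<Rightarrow> bool" where
  "subgraph S G \<longleftrightarrow> verts S \<subseteq> verts G \<and> edges S \<subseteq> edges G"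

definition isomorphic :: "'a graph \<Rightarrow> 'b graph \<Rightarrow> bool" where
  "isomorphic G H \<longleftrightarrow>
     (\<exists>f. bij_betw f (verts G) (verts H) \<and> bij_betw ((`) f) (edges G) (edges H))"

definition F_graph :: "'a graph \<Rightarrow> 'b graph \<Rightarrow> bool" where
  "F_graph F S \<longleftrightarrow> is_graph S \<and> isomorphic S F"

definition F_subgraphs :: "'a graph \<Rightarrow> 'b graph \<Rightarrow> 'b graph set" where
  "F_subgraphs F G = {S. subgraph S G \<and> F_graph F S}"

definition SG :: "'a graph \<Rightarrow> nat \<Rightarrow> nat \<Rightarrow> nat \<Rightarrow> nat" where
  "SG F n m t = card {G. nm_graph n m G \<and> card (F_subgraphs F G) = t}"

definition patch_union :: "'b graph set \<Rightarrow> 'b graph" where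
  "patch_union P = (\<Union>S\<in>P. verts S, \<Union>S\<in>P. edges S)"

definition patchwork :: "'a graph \<Rightarrow> 'b graph set \<Rightarrow> bool" where
  "patchwork F P \<longleftrightarrow> finite P \<and> (\<forall>S\<in>P. F_graph F S) \<and> is_graph (patch_union P)"

definition Patch_num :: "'a graph \<Rightarrow> nat \<Rightarrow> nat \<Rightarrow> nat \<Rightarrow> nat" where
  "Patch_num F n m t = card {P. patchwork F P \<and> card P = t \<and> nm_graph n m (patch_union P)}"

text \<open>
  Series in z, w, u are nested: the outer power series is in z, its coefficients are
  power series in w, whose coefficients are polynomials in u.
  Using polynomials for u makes the substitution of u - 1 for u meaningful.
\<close>

type_synonym zwu_series = "rat poly fps fps"

definition coeff_zwu :: "zwu_series \<Rightarrow> nat \<Rightarrow> nat \<Rightarrow> nat \<Rightarrow> rat" where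
  "coeff_zwu A n m t = coeff (fps_nth (fps_nth A n) m) t"

text \<open>
  Without a finite support \<open>Abs_poly\<close> would be unspecified; \<open>coeff_zwu_Patch\<close> below shows
  that the coefficients are the intended ones.
\<close>

definition Patch :: "'a graph \<Rightarrow> zwu_series" where
  "Patch F = Abs_fps (\<lambda>n. Abs_fps (\<lambda>m. Abs_poly (\<lambda>t. of_nat (Patch_num F n m t) / fact n)))"

definition fps_map :: "('a \<Rightarrow> 'b) \<Rightarrow> 'a fps \<Rightarrow> 'b fps" where
  "fps_map h A = Abs_fps (\<lambda>n. h (fps_nth A n))"

definition in_z :: "rat fps \<Rightarrow> zwu_series" where
  "in_z A = fps_map (\<lambda>c. fps_const [:c:]) A"

definition in_w :: "rat fps \<Rightarrow> zwu_series" where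
  "in_w B = fps_const (fps_map (\<lambda>c. [:c:]) B)"

text \<open>
  A(z, b(w), q(u)) for a series A(z, w, u); \<open>fps_compose\<close> is the genuine composition
  only if b has constant term 0.
\<close>

definition subst_wu :: "zwu_series \<Rightarrow> rat fps \<Rightarrow> rat poly \<Rightarrow> zwu_series" where
  "subst_wu A b q =
     fps_map (\<lambda>B. fps_compose (fps_map (\<lambda>p. pcompose p q) B) (fps_map (\<lambda>c. [:c:]) b)) A"

lemma finite_patchworks:
  "finite {P :: nat graph set. patchwork F P \<and> nm_graph n m (patch_union P)}"
proof (rule finite_subset)
  show "{P :: nat graph set. patchwork F P \<and> nm_graph n m (patch_union P)}
          \<subseteq> Pow (Pow {1..n} \<times> Pow (Pow {1..n}))"
    by (fastforce simp: patchwork_def nm_graph_def patch_union_def is_graph_def)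
qed auto

lemma finite_nm_graphs: "finite {G. nm_graph n m G}"
proof (rule finite_subset)
  show "{G. nm_graph n m G} \<subseteq> Pow {1..n} \<times> Pow (Pow {1..n})"
    by (fastforce simp: nm_graph_def is_graph_def)
qed auto

lemma coeff_zwu_Patch:
  "coeff_zwu (Patch F) n m t = of_nat (Patch_num F n m t) / fact n"
proof -
  let ?A = "{P :: nat graph set. patchwork F P \<and> nm_graph n m (patch_union P)}"
  have "{t. Patch_num F n m t \<noteq> 0} \<subseteq> card ` ?A"
  proof
    fix t assume "t \<in> {t. Patch_num F n m t \<noteq> 0}"
    then have "{P. patchwork F P \<and> card P = t \<and> nm_graph n m (patch_union P)} \<noteq> {}"
      by (auto simp: Patch_num_def simp del: Collect_empty_eq)
    then show "t \<in> card ` ?A" by blast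
  qed
  then have "finite {t. Patch_num F n m t \<noteq> 0}"
    using finite_patchworks finite_surj by blast
  then have "\<forall>\<^sub>\<infinity>t. of_nat (Patch_num F n m t) / fact n = (0::rat)"
    by (simp add: MOST_iff_cofinite)
  then show ?thesis
    by (simp add: coeff_zwu_def Patch_def Abs_poly_inverse)
qed

end

theory Submission
  imports Defs
begin

text \<open>
  Writing \<open>u = (u - 1) + 1\<close>, the weight \<open>u\<close> to the number of \<open>F\<close>-subgraphs of \<open>G\<close> is the sum of
  \<open>(u - 1)\<close> to the number of elements over all sets of \<open>F\<close>-subgraphs of \<open>G\<close>, and these sets are
  the patchworks whose union is a subgraph of \<open>G\<close>. After exchanging summations, a patchwork with
  \<open>a\<close> vertices and \<open>k\<close> edges is counted once for every \<open>(n,m)\<close>-graph above its union. There are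
  \<open>(N - k) choose (m - k)\<close> of these, where \<open>N = n choose 2\<close>, which is the coefficient of \<open>w\<^sup>m\<close>
  in \<open>(w / (1 + w))\<^sup>k (1 + w)\<^sup>N\<close>. Relabelling the vertices gives the factor \<open>n choose a\<close>, which
  the exponential generating function absorbs into \<open>e\<^sup>z\<close>.
\<close>

section \<open>Relabelling of graphs and patchworks\<close>

definition relabel :: "('a \<Rightarrow> 'b) \<Rightarrow> 'a graph \<Rightarrow> 'b graph" where
  "relabel f G = (f ` verts G, (`) f ` edges G)"

lemma relabel_comp: "relabel f (relabel g G) = relabel (f \<circ> g) G"
  by (simp add: relabel_def image_comp comp_def)

lemma relabel_id: "relabel id G = G"
  by (simp add: relabel_def)

lemma is_graph_relabel:
  assumes "inj f" and "is_graph G"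
  shows "is_graph (relabel f G)"
  using assms by (fastforce simp: is_graph_def relabel_def card_image inj_on_subset)

lemma isomorphic_relabel:
  assumes "inj f" and "isomorphic G H"
  shows "isomorphic (relabel f G) H"
proof -
  obtain g where g: "bij_betw g (verts G) (verts H)" "bij_betw ((`) g) (edges G) (edges H)"
    using assms(2) by (auto simp: isomorphic_def)
  have inv: "inv f ` f ` X = X" for X
    using assms(1) by (simp add: image_comp)
  have "bij_betw (inv f) (f ` verts G) (verts G)"
    using assms(1) by (auto simp: bij_betw_def inj_on_def image_comp)
  moreover have "bij_betw ((`) (inv f)) ((`) f ` edges G) (edges G)"
    by (auto simp: bij_betw_def inj_on_def inv image_iff)
  moreover have "(`) (g \<circ> inv f) = (`) g \<circ> (`) (inv f)"
    by (auto simp: image_comp)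
  ultimately have "bij_betw (g \<circ> inv f) (f ` verts G) (verts H)"
    "bij_betw ((`) (g \<circ> inv f)) ((`) f ` edges G) (edges H)"
    using g by (metis bij_betw_trans)+
  then show ?thesis
    unfolding isomorphic_def relabel_def by auto
qed

lemma F_graph_relabel: "inj f \<Longrightarrow> F_graph F S \<Longrightarrow> F_graph F (relabel f S)"
  by (simp add: F_graph_def is_graph_relabel isomorphic_relabel)

lemma patch_union_relabel: "patch_union (relabel f ` P) = relabel f (patch_union P)"
  by (auto simp: patch_union_def relabel_def)

lemma patchwork_relabel: "inj f \<Longrightarrow> patchwork F P \<Longrightarrow> patchwork F (relabel f ` P)"
  by (auto simp: patchwork_def patch_union_relabel is_graph_relabel F_graph_relabel)

lemma inj_relabel: "inj f \<Longrightarrow> inj (relabel f)"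
  by (rule inj_on_inverseI[where g = "relabel (inv f)"]) (simp add: relabel_comp relabel_id)

text \<open>The vertex set is arbitrary because a patchwork inside an (n,m)-graph may cover any
  subset of \<open>{1..n}\<close>; \<open>Patch_num\<close> counts the case of an initial segment.
  The number of members is left free, to be carried as an exponent.\<close>

definition patchworks_on :: "'a graph \<Rightarrow> 'b set \<Rightarrow> nat \<Rightarrow> 'b graph set set" where
  "patchworks_on F A k =
     {P. patchwork F P \<and> verts (patch_union P) = A \<and> card (edges (patch_union P)) = k}"

lemma finite_patchworks_on:
  assumes "finite A"
  shows "finite (patchworks_on F A k)"
proof (rule finite_subset)
  have "S \<in> Pow A \<times> Pow (Pow A)" if "P \<in> patchworks_on F A k" "S \<in> P" for P S
  proof -
    have "is_graph S" and "verts S \<subseteq> A"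
      using that by (auto simp: patchworks_on_def patchwork_def F_graph_def patch_union_def)
    then show ?thesis
      by (cases S) (auto simp: is_graph_def)
  qed
  then show "patchworks_on F A k \<subseteq> Pow (Pow A \<times> Pow (Pow A))"
    by blast
qed (use assms in auto)

lemma relabel_patchworks_on:
  assumes "inj f" and "P \<in> patchworks_on F A k"
  shows "relabel f ` P \<in> patchworks_on F (f ` A) k"
proof -
  have "inj ((`) f)"
    using assms(1) by (simp add: inj_image_eq_iff inj_def)
  then show ?thesis
    using assms
    by (auto simp: patchworks_on_def patchwork_relabel patch_union_relabel)
       (simp_all add: relabel_def card_image inj_on_subset)
qed

text \<open>Relabelling by \<open>f\<close> and by \<open>inv f\<close> are mutually inverse on
  patchworks and keep the number of members. Bijectivity on the whole type makes
  \<open>inv f\<close> injective too, so the same lemma serves both directions.\<close>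

lemma sum_patchworks_on_relabel:
  assumes "bij f"
  shows "(\<Sum>P\<in>patchworks_on F A k. h (card P)) = (\<Sum>P\<in>patchworks_on F (f ` A) k. h (card P))"
proof (rule sum.reindex_bij_witness[where i = "(`) (relabel (inv f))" and j = "(`) (relabel f)"])
  have inj: "inj f" "inj (inv f)" and inv: "inv f \<circ> f = id" "f \<circ> inv f = id"
    using assms by (auto simp: bij_is_inj bij_is_surj bij_imp_bij_inv simp flip: surj_iff)
  show "relabel (inv f) ` relabel f ` P = P" for P
    by (simp only: image_comp comp_def[of "relabel _"] relabel_comp inv relabel_id image_ident)
  show "relabel f ` relabel (inv f) ` P = P" for P
    by (simp only: image_comp comp_def[of "relabel _"] relabel_comp inv relabel_id image_ident)
  show "relabel f ` P \<in> patchworks_on F (f ` A) k" if "P \<in> patchworks_on F A k" for P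
    using that inj(1) by (rule relabel_patchworks_on[rotated])
  show "relabel (inv f) ` P \<in> patchworks_on F A k" if "P \<in> patchworks_on F (f ` A) k" for P
    using relabel_patchworks_on[OF inj(2) that] by (simp add: image_comp inv)
  show "h (card (relabel f ` P)) = h (card P)" for P
    using inj_relabel[OF inj(1)] by (simp add: card_image inj_on_subset)
qed

text \<open>Finite sets of naturals have countably infinite complements, so a bijection between the
  sets can be glued to one between the complements. This provides the global bijection that
  relabelling asks for.\<close>

lemma ex_bij_image_eq:
  fixes A B :: "nat set"
  assumes "finite A" "finite B" "card A = card B"
  shows "\<exists>f. bij f \<and> f ` A = B"
proof -
  obtain g where g: "bij_betw g A B"
    using assms by (metis finite_same_card_bij)
  have "infinite (- A)" "infinite (- B)"
    using assms by (simp_all add: Compl_eq_Diff_UNIV)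
  then obtain h where h: "bij_betw h (- A) (- B)"
    by (metis bij_enumerate bij_betw_inv bij_betw_trans)
  let ?f = "\<lambda>x. if x \<in> A then g x else h x"
  have "bij_betw ?f (A \<union> - A) (B \<union> - B)"
  proof (rule bij_betw_combine)
    show "bij_betw ?f A B"
      using g by (simp cong: bij_betw_cong)
    have "bij_betw ?f (- A) (- B) \<longleftrightarrow> bij_betw h (- A) (- B)"
      by (rule bij_betw_cong) simp
    with h show "bij_betw ?f (- A) (- B)"
      by simp
  qed simp
  then have "bij ?f"
    by (simp only: Compl_partition)
  moreover have "?f ` A = B"
    using g by (simp add: bij_betw_def)
  ultimately show ?thesis
    by blast
qed

lemma sum_patchworks_on_card:
  fixes A :: "nat set"
  assumes "finite A"
  shows "(\<Sum>P\<in>patchworks_on F A k. h (card P))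
       = (\<Sum>P\<in>patchworks_on F {1..card A} k. h (card P))"
  using ex_bij_image_eq[of A "{1..card A}"] assms sum_patchworks_on_relabel
  by (metis card_atLeastAtMost diff_Suc_1 finite_atLeastAtMost)

section \<open>Counting the graphs above a given graph\<close>

lemma card_nm_supergraphs:
  fixes S :: "nat graph"
  assumes "is_graph S" and "verts S \<subseteq> {1..n}" and "card (edges S) \<le> m"
  shows "card {G. nm_graph n m G \<and> subgraph S G}
       = ((n choose 2) - card (edges S)) choose (m - card (edges S))"
proof -
  define K where "K = {e. e \<subseteq> {1..n} \<and> card e = 2}"
  have K: "finite K" "card K = n choose 2"
    using n_subsets[of "{1..n}" 2] by (auto simp: K_def)
  have S: "edges S \<subseteq> K"
    using assms by (auto simp: is_graph_def K_def)
  with K have fin: "finite (edges S)"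
    by (metis finite_subset)
  \<comment> \<open>A supergraph is determined by its additional edges, chosen freely among the
    pairs in \<open>K\<close> that are not edges of \<open>S\<close>.\<close>
  have "bij_betw (\<lambda>E. ({1..n}, edges S \<union> E))
          {E. E \<subseteq> K - edges S \<and> card E = m - card (edges S)}
          {G. nm_graph n m G \<and> subgraph S G}"
  proof (rule bij_betwI[where g = "\<lambda>G. edges G - edges S"])
    show "(\<lambda>E. ({1..n}, edges S \<union> E)) \<in> {E. E \<subseteq> K - edges S \<and> card E = m - card (edges S)}
        \<rightarrow> {G. nm_graph n m G \<and> subgraph S G}"
    proof
      fix E assume E: "E \<in> {E. E \<subseteq> K - edges S \<and> card E = m - card (edges S)}"
      then have "finite E"
        using K(1) by (metis finite_Diff finite_subset mem_Collect_eq)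
      with E fin have "card (edges S \<union> E) = m"
        using assms(3) by (subst card_Un_disjoint) auto
      with E S show "({1..n}, edges S \<union> E) \<in> {G. nm_graph n m G \<and> subgraph S G}"
        using assms(2) by (auto simp: nm_graph_def subgraph_def is_graph_def K_def)
    qed
    show "(\<lambda>G. edges G - edges S) \<in> {G. nm_graph n m G \<and> subgraph S G}
        \<rightarrow> {E. E \<subseteq> K - edges S \<and> card E = m - card (edges S)}"
      using fin by (auto simp: nm_graph_def subgraph_def is_graph_def K_def card_Diff_subset)
  qed (auto simp: nm_graph_def subgraph_def)
  then have "card {G. nm_graph n m G \<and> subgraph S G}
      = card {E. E \<subseteq> K - edges S \<and> card E = m - card (edges S)}"
    by (rule bij_betw_same_card[symmetric])
  also have "\<dots> = ((n choose 2) - card (edges S)) choose (m - card (edges S))"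
    using K S fin by (simp add: n_subsets card_Diff_subset)
  finally show ?thesis .
qed

lemma card_edges_le:
  assumes "is_graph S" and "finite A" and "verts S \<subseteq> A"
  shows "card (edges S) \<le> card A choose 2"
proof -
  have "edges S \<subseteq> {e. e \<subseteq> A \<and> card e = 2}"
    using assms by (auto simp: is_graph_def)
  then show ?thesis
    using assms n_subsets[of A 2]
    by (metis (no_types, lifting) card_mono finite_Collect_subsets finite_subset
        mem_Collect_eq subsetI)
qed

section \<open>Sets of F-subgraphs as patchworks\<close>

lemma is_graph_patch_union:
  assumes "\<And>S. S \<in> P \<Longrightarrow> is_graph S" and "finite (verts (patch_union P))"
  shows "is_graph (patch_union P)"
  using assms unfolding is_graph_def patch_union_def fst_conv snd_conv by blast

lemma subgraph_patch_union_iff: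
  "subgraph (patch_union P) G \<longleftrightarrow> (\<forall>S\<in>P. subgraph S G)"
  unfolding subgraph_def patch_union_def fst_conv snd_conv by blast

lemma finite_subgraphs:
  assumes "is_graph G"
  shows "finite {S. subgraph S G}"
proof (rule finite_subset)
  have "finite (verts G)" "edges G \<subseteq> Pow (verts G)"
    using assms by (auto simp: is_graph_def)
  then show "finite (Pow (verts G) \<times> Pow (edges G))"
    by (auto dest: finite_subset)
  show "{S. subgraph S G} \<subseteq> Pow (verts G) \<times> Pow (edges G)"
    by (auto simp: subgraph_def)
qed

text \<open>The union lies in \<open>G\<close> exactly when every member does. The finiteness that a
  patchwork demands is inherited from \<open>G\<close>, which has finitely many subgraphs.\<close>

lemma subset_F_subgraphs_iff:
  assumes "is_graph G"
  shows "P \<subseteq> F_subgraphs F G \<longleftrightarrow> patchwork F P \<and> subgraph (patch_union P) G"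
proof
  assume P: "P \<subseteq> F_subgraphs F G"
  then have sub: "subgraph (patch_union P) G"
    unfolding subgraph_patch_union_iff F_subgraphs_def by blast
  moreover have "finite (verts G)"
    using assms by (simp add: is_graph_def)
  ultimately have "finite (verts (patch_union P))"
    by (metis finite_subset subgraph_def)
  moreover have "finite P"
    using P finite_subgraphs[OF assms] unfolding F_subgraphs_def
    by (metis (no_types, lifting) Collect_mono finite_subset)
  moreover have "\<forall>S\<in>P. F_graph F S"
    using P unfolding F_subgraphs_def by blast
  ultimately have "patchwork F P"
    unfolding patchwork_def by (simp add: is_graph_patch_union F_graph_def)
  with sub show "patchwork F P \<and> subgraph (patch_union P) G"
    by (rule conjI[rotated])
next
  assume "patchwork F P \<and> subgraph (patch_union P) G"
  then show "P \<subseteq> F_subgraphs F G"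
    unfolding subgraph_patch_union_iff patchwork_def F_subgraphs_def by blast
qed

lemma finite_F_subgraphs:
  assumes "is_graph G"
  shows "finite (F_subgraphs F G)"
  using subset_F_subgraphs_iff[OF assms, of "F_subgraphs F G" F] by (simp add: patchwork_def)

section \<open>Double counting of graphs and patchworks\<close>

lemma sum_Pow_power_card:
  fixes x :: "'a :: comm_semiring_1"
  assumes "finite A"
  shows "(\<Sum>B\<in>Pow A. x ^ card B) = (x + 1) ^ card A"
  using prod_add[OF assms, of "\<lambda>_. x" "\<lambda>_. 1"] by (simp add: add.commute)

lemma sum_nm_graphs_eq_sum_patchworks:
  fixes x :: "'a :: comm_semiring_1"
  shows "(\<Sum>G | nm_graph n m G. (x + 1) ^ card (F_subgraphs F G))
       = (\<Sum>a\<le>n. \<Sum>k\<le>m. of_nat (n choose a) * of_nat (((n choose 2) - k) choose (m - k))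
            * (\<Sum>P\<in>patchworks_on F {1..a} k. x ^ card P))"
proof -
  let ?c = "\<lambda>k. of_nat (((n choose 2) - k) choose (m - k)) :: 'a"
  let ?S = "\<lambda>A k. \<Sum>P\<in>patchworks_on F A k. x ^ card P"
  \<comment> \<open>A finite range for \<open>P\<close> that does not depend on \<open>G\<close>, so
    that the two sums can be exchanged. Its bounds hold for every patchwork whose union lies in an
    (n,m)-graph.\<close>
  let ?W = "{P :: nat graph set. patchwork F P \<and> verts (patch_union P) \<subseteq> {1..n}
               \<and> card (edges (patch_union P)) \<le> m}"
  have W: "?W = (\<Union>A\<in>Pow {1..n}. \<Union>k\<in>{..m}. patchworks_on F A k)"
    by (auto simp: patchworks_on_def)
  have fin: "finite (patchworks_on F A k)" if "A \<subseteq> {1..n}" for A :: "nat set" and k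
    using that by (intro finite_patchworks_on) (auto dest: finite_subset)
  have finW: "finite ?W"
    unfolding W using fin by auto
  have finG: "finite {G. nm_graph n m G}"
    by (rule finite_nm_graphs)
  have Pow_eq: "Pow (F_subgraphs F G) = {P \<in> ?W. subgraph (patch_union P) G}"
    if G: "nm_graph n m G" for G
  proof -
    have "is_graph G" "verts G = {1..n}" "card (edges G) = m"
      using G by (auto simp: nm_graph_def)
    moreover from this have "finite (edges G)"
      by (auto simp: is_graph_def intro!: finite_subset[of "edges G" "Pow (verts G)"])
    ultimately show ?thesis
      unfolding Pow_def subset_F_subgraphs_iff[OF \<open>is_graph G\<close>] subgraph_def
      using card_mono[OF \<open>finite (edges G)\<close>] by blast
  qed
  have "(\<Sum>G | nm_graph n m G. (x + 1) ^ card (F_subgraphs F G))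
      = (\<Sum>G | nm_graph n m G. \<Sum>P | P \<in> ?W \<and> subgraph (patch_union P) G. x ^ card P)"
  proof (rule sum.cong[OF refl])
    fix G assume "G \<in> {G. nm_graph n m G}"
    then have "nm_graph n m G" and "is_graph G"
      by (auto simp: nm_graph_def)
    then show "(x + 1) ^ card (F_subgraphs F G)
        = (\<Sum>P | P \<in> ?W \<and> subgraph (patch_union P) G. x ^ card P)"
      by (simp only: sum_Pow_power_card[OF finite_F_subgraphs, symmetric] Pow_eq)
  qed
  also have "\<dots> = (\<Sum>P\<in>?W. \<Sum>G | G \<in> {G. nm_graph n m G} \<and> subgraph (patch_union P) G. x ^ card P)"
    using sum.swap_restrict[OF finG finW, of "\<lambda>_ P. x ^ card P" "\<lambda>G P. subgraph (patch_union P) G"]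
    by simp
  \<comment> \<open>The summand is constant in \<open>G\<close>, so only the number of supergraphs
    remains; the edge bound in \<open>?W\<close> is the hypothesis of
    \<open>card_nm_supergraphs\<close>.\<close>
  also have "\<dots> = (\<Sum>P\<in>?W. ?c (card (edges (patch_union P))) * x ^ card P)"
    by (rule sum.cong) (auto simp: card_nm_supergraphs patchwork_def)
  also have "\<dots> = (\<Sum>A\<in>Pow {1..n}. \<Sum>P\<in>(\<Union>k\<in>{..m}. patchworks_on F A k).
                     ?c (card (edges (patch_union P))) * x ^ card P)"
    unfolding W using fin by (intro sum.UNION_disjoint) (auto simp: patchworks_on_def)
  also have "\<dots> = (\<Sum>A\<in>Pow {1..n}. \<Sum>k\<le>m. \<Sum>P\<in>patchworks_on F A k.
                     ?c (card (edges (patch_union P))) * x ^ card P)"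
    using fin by (intro sum.cong sum.UNION_disjoint refl) (auto simp: patchworks_on_def)
  also have "\<dots> = (\<Sum>A\<in>Pow {1..n}. \<Sum>k\<le>m. ?c k * ?S A k)"
    by (intro sum.cong refl) (auto simp: patchworks_on_def sum_distrib_left)
  also have "\<dots> = (\<Sum>A\<in>Pow {1..n}. \<Sum>k\<le>m. ?c k * ?S {1..card A} k)"
  proof (intro sum.cong refl)
    fix A k assume "A \<in> Pow {1..n}"
    then have "finite A"
      by (auto dest: finite_subset)
    then show "?c k * ?S A k = ?c k * ?S {1..card A} k"
      by (simp only: sum_patchworks_on_card[of A "\<lambda>i. x ^ i"])
  qed
  \<comment> \<open>The inner sum now depends on \<open>A\<close> only through its size, and
    \<open>n choose a\<close> subsets have size \<open>a\<close>.\<close>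
  also have "\<dots> = (\<Sum>a\<le>n. \<Sum>A | A \<in> Pow {1..n} \<and> card A = a. \<Sum>k\<le>m. ?c k * ?S {1..card A} k)"
    by (rule sum.group[symmetric]) (auto dest: card_mono[rotated])
  also have "\<dots> = (\<Sum>a\<le>n. of_nat (n choose a) * (\<Sum>k\<le>m. ?c k * ?S {1..a} k))"
    using n_subsets[of "{1..n}"] by (intro sum.cong refl) (simp add: Pow_def)
  finally show ?thesis
    by (simp add: sum_distrib_left mult.assoc)
qed

section \<open>Coefficients of the nested power series\<close>

lemma fps_map_nth: "fps_nth (fps_map h A) n = h (fps_nth A n)"
  by (simp add: fps_map_def)

text \<open>With the version for powers, this moves the factors in \<open>w\<close> back to rational
  coefficients, a field, where \<open>fps_nth_X_div_power_mult\<close> applies.\<close>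

lemma fps_map_const_poly_mult:
  fixes A B :: "'a :: comm_semiring_1 fps"
  shows "fps_map (\<lambda>c. [:c:]) (A * B) = fps_map (\<lambda>c. [:c:]) A * fps_map (\<lambda>c. [:c:]) B"
proof -
  have "[:sum f I:] = (\<Sum>i\<in>I. [:f i:])" for f :: "nat \<Rightarrow> 'a" and I
    by (rule poly_eqI) (simp add: coeff_sum coeff_pCons split: nat.split)
  then show ?thesis
    by (intro fps_ext) (simp add: fps_map_nth fps_mult_nth mult.commute)
qed

lemma fps_map_const_poly_power:
  fixes A :: "'a :: comm_semiring_1 fps"
  shows "fps_map (\<lambda>c. [:c:]) (A ^ i) = fps_map (\<lambda>c. [:c:]) A ^ i"
proof (induction i)
  case 0
  show ?case
    by (rule fps_ext) (auto simp: fps_map_nth one_pCons)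
qed (simp add: fps_map_const_poly_mult)

text \<open>As \<open>c\<close> has no constant term, \<open>c ^ i\<close> has no terms below degree
  \<open>i\<close>. Hence the sum over \<open>i \<le> j\<close> in the coefficient of degree
  \<open>j\<close> may run to \<open>m\<close> for every \<open>j\<close>, and the two sums can be
  exchanged.\<close>

lemma fps_compose_mult_nth:
  fixes B :: "'a :: comm_ring_1 fps"
  assumes "fps_nth c 0 = 0"
  shows "fps_nth (fps_compose B c * D) m = (\<Sum>i\<le>m. fps_nth B i * fps_nth (c ^ i * D) m)"
proof -
  have "fps_nth (fps_compose B c * D) m
      = (\<Sum>j\<le>m. (\<Sum>i\<le>m. fps_nth B i * fps_nth (c ^ i) j) * fps_nth D (m - j))"
    unfolding fps_mult_nth atLeast0AtMost fps_compose_nth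
    by (intro sum.cong arg_cong2[where f = times] refl sum.mono_neutral_left)
       (auto simp: startsby_zero_power_prefix[OF assms])
  also have "\<dots> = (\<Sum>i\<le>m. fps_nth B i * fps_nth (c ^ i * D) m)"
    unfolding fps_mult_nth atLeast0AtMost sum_distrib_left sum_distrib_right
    by (subst sum.swap) (simp add: mult.assoc)
  finally show ?thesis .
qed

text \<open>Cancelling \<open>i\<close> factors \<open>1 + w\<close> leaves
  \<open>w^i (1 + w)^(N - i)\<close>. For \<open>i > N\<close> a negative power of
  \<open>1 + w\<close> would remain, and the truncated subtraction would give a wrong binomial
  coefficient.\<close>

lemma fps_nth_X_div_power_mult:
  assumes "i \<le> N" and "i \<le> m"
  shows "fps_nth ((fps_X / (1 + fps_X)) ^ i * (1 + fps_X) ^ N :: 'a :: field_char_0 fps) m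
       = of_nat ((N - i) choose (m - i))"
proof -
  let ?y = "1 + fps_X :: 'a fps"
  have "(fps_X / ?y) * ?y = fps_X"
    by (simp add: fps_divide_unit mult.assoc inverse_mult_eq_1)
  then have "fps_X ^ i = (fps_X / ?y) ^ i * ?y ^ i"
    by (metis power_mult_distrib)
  moreover have "?y ^ N = ?y ^ i * ?y ^ (N - i)"
    using assms(1) by (simp only: flip: power_add) simp
  ultimately have "(fps_X / ?y) ^ i * ?y ^ N = fps_X ^ i * ?y ^ (N - i)"
    by (simp only: mult.assoc)
  then show ?thesis
    using assms(2)
    by (simp add: fps_X_power_mult_nth binomial_gbinomial flip: fps_binomial_of_nat)
qed

text \<open>Summing over patchworks instead of over \<open>t\<close> lets the substitution of
  \<open>u - 1\<close> act on each monomial separately.\<close>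

lemma nth_nth_Patch:
  "fps_nth (fps_nth (Patch F) a) k
     = smult (1 / fact a) (\<Sum>P\<in>patchworks_on F {1..a} k. monom 1 (card P))"
proof (rule poly_eqI)
  fix t
  have eq: "{P. patchwork F P \<and> card P = t \<and> nm_graph a k (patch_union P)}
      = {P \<in> patchworks_on F {1..a} k. card P = t}"
    by (auto simp: patchworks_on_def nm_graph_def patchwork_def)
  have "coeff (\<Sum>P\<in>patchworks_on F {1..a} k. monom (1::rat) (card P)) t = of_nat (Patch_num F a k t)"
    unfolding Patch_num_def eq using finite_patchworks_on[of "{1..a}" F k]
    by (simp add: coeff_sum sum.If_cases Int_def)
  then show "coeff (fps_nth (fps_nth (Patch F) a) k) t
      = coeff (smult (1 / fact a) (\<Sum>P\<in>patchworks_on F {1..a} k. monom 1 (card P))) t"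
    using coeff_zwu_Patch[of F a k t] by (simp add: coeff_zwu_def)
qed

lemma pcompose_monom_1: "pcompose (monom 1 k) q = (q :: 'a :: comm_semiring_1 poly) ^ k"
  by (induction k) (simp_all add: monom_0 monom_Suc pcompose_pCons one_pCons)

lemma patchworks_on_empty:
  assumes "card A choose 2 < k" and "finite A"
  shows "patchworks_on F A k = {}"
  using card_edges_le[of "patch_union _" A] assms
  by (fastforce simp: patchworks_on_def patchwork_def)

section \<open>Comparison of coefficients\<close>

theorem theorem2:
  fixes F :: "'a graph" and n m t :: nat
  assumes "is_graph F"
  shows "of_nat (SG F n m t) =
    fact n * coeff_zwu
      (subst_wu (Patch F) (fps_X / (1 + fps_X)) [:-1, 1:]
         * in_z (fps_exp 1) * in_w ((1 + fps_X) ^ (n choose 2))) n m t"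
proof -
  have smult_sum_right: "smult c (sum f I) = (\<Sum>i\<in>I. smult c (f i))"
    for c :: rat and f :: "nat \<Rightarrow> rat poly" and I
    by (rule poly_eqI) (simp add: coeff_sum sum_distrib_left)
  let ?x = "[:-1, 1:] :: rat poly"
  let ?N = "n choose 2"
  let ?const = "fps_map (\<lambda>c::rat. [:c:])"
  let ?b = "fps_X / (1 + fps_X) :: rat fps"
  define Q where "Q a i = (\<Sum>P\<in>patchworks_on F {1..a::nat} i. ?x ^ card P)" for a i
  define B where "B a = fps_map (\<lambda>p. pcompose p ?x) (fps_nth (Patch F) a)" for a
  define A where "A = subst_wu (Patch F) ?b ?x * in_z (fps_exp 1) * in_w ((1 + fps_X) ^ ?N)"
  \<comment> \<open>This covers the indices excluded from \<open>fps_nth_X_div_power_mult\<close>: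
    on at most \<open>n\<close> vertices no patchwork has more than \<open>?N\<close> edges.\<close>
  have Q0: "Q a i = 0" if "a \<le> n" "?N < i" for a i
  proof -
    have "a choose 2 < i"
      using that binomial_right_mono[of a n 2] by linarith
    then show ?thesis
      by (simp add: Q_def patchworks_on_empty)
  qed
  have B_nth: "fps_nth (B a) i = smult (1 / fact a) (Q a i)" for a i
    by (simp add: B_def fps_map_nth nth_nth_Patch pcompose_smult pcompose_sum pcompose_monom_1 Q_def)
  have "fps_nth ?b 0 = 0"
    by (simp add: fps_divide_unit)
  then have b0: "fps_nth (?const ?b) 0 = 0"
    by (simp add: fps_map_nth)
  have term_eq: "fps_nth (B a) i * fps_nth (?const ?b ^ i * ?const ((1 + fps_X) ^ ?N)) m
      = smult (1 / fact a) (of_nat ((?N - i) choose (m - i)) * Q a i)"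
    if "a \<le> n" "i \<le> m" for a i
  proof (cases "i \<le> ?N")
    case True
    have "fps_nth (?const ?b ^ i * ?const ((1 + fps_X) ^ ?N)) m
        = [:fps_nth (?b ^ i * (1 + fps_X) ^ ?N) m:]"
      by (simp only: flip: fps_map_const_poly_mult fps_map_const_poly_power) (simp add: fps_map_nth)
    also have "\<dots> = of_nat ((?N - i) choose (m - i))"
      using True that by (simp only: fps_nth_X_div_power_mult of_nat_poly)
    finally show ?thesis
      by (simp add: B_nth mult.commute)
  next
    case False
    with that show ?thesis
      by (simp add: B_nth Q0)
  qed
  \<comment> \<open>The exponential contributes \<open>1 / (n - a)!\<close>, and the factor
    \<open>in_w\<close> is constant in \<open>z\<close>. With the \<open>1 / a!\<close> inside
    \<open>B a\<close> and the outer \<open>n!\<close> this becomes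
    \<open>n choose a\<close>.\<close>
  have A_nth: "fps_nth A n = (\<Sum>a\<le>n. fps_const [:1 / fact (n - a):]
      * (fps_compose (B a) (?const ?b) * ?const ((1 + fps_X) ^ ?N)))"
    by (simp add: A_def in_w_def fps_mult_nth[of _ "in_z _"] atLeast0AtMost sum_distrib_right)
       (simp add: subst_wu_def in_z_def B_def fps_map_nth mult_ac)
  have "smult (fact n) (fps_nth (fps_nth A n) m)
      = (\<Sum>a\<le>n. \<Sum>k\<le>m. smult (fact n / (fact a * fact (n - a)))
           (of_nat ((?N - k) choose (m - k)) * Q a k))"
    unfolding A_nth
    by (simp add: fps_sum_nth fps_compose_mult_nth[OF b0] term_eq smult_sum_right mult.commute)
  also have "\<dots> = (\<Sum>a\<le>n. \<Sum>k\<le>m. of_nat (n choose a) * of_nat ((?N - k) choose (m - k)) * Q a k)"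
    by (intro sum.cong refl) (simp add: of_nat_poly binomial_fact mult.commute)
  also have "\<dots> = (\<Sum>G | nm_graph n m G. (?x + 1) ^ card (F_subgraphs F G))"
    unfolding Q_def by (rule sum_nm_graphs_eq_sum_patchworks[symmetric])
  \<comment> \<open>This is the variable \<open>u\<close> itself, so each graph contributes
    \<open>u\<close> to the number of its F-subgraphs, and the coefficient at \<open>t\<close>
    counts the graphs with exactly \<open>t\<close> of them.\<close>
  also have "?x + 1 = monom 1 1"
    by (simp add: one_pCons monom_altdef)
  finally have "coeff (smult (fact n) (fps_nth (fps_nth A n) m)) t
      = (\<Sum>G | nm_graph n m G. if card (F_subgraphs F G) = t then 1 else 0)"
    by (simp add: monom_power coeff_sum)
  also have "\<dots> = of_nat (SG F n m t)"
    using finite_nm_graphs[of n m] by (simp add: SG_def sum.If_cases Int_def)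
  finally show ?thesis
    by (simp add: coeff_zwu_def A_def)
qed

end
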